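(* Let $n\ge 2$ be an integer and $q$ a prime power. There exist $N\ge 1$ and a cyclic sequence $\mathcal{C}=(p_i)_{i\in\mathbb{Z}/N\mathbb{Z}}$ of points of $\mathrm{PG}(n,q)$ such that (1) for every $i$, the window $(p_i,p_{i+1})$ represents a well-defined affine line of $\mathrm{AG}(n,q)$, and (2) every affine line of $\mathrm{AG}(n,q)$ is represented by exactly one window $(p_i,p_{i+1})$, $i\in\mathbb{Z}/N\mathbb{Z}$. (The points $p_i$ may be affine points or points at infinity.)
   Context: $\mathrm{AG}(n,q)$ denotes the affine space $\mathbb{F}_q^{\,n}$; its affine lines are the sets $x+\ell$ with $x\in\mathbb{F}_q^{\,n}$ and $\ell\subset\mathbb{F}_q^{\,n}$ a $1$-dimensional linear subspace (the direction of the line). $\mathrm{PG}(n,q)$ is the projective completion of $\mathrm{AG}(n,q)$: its points are the affine points $x\in\mathbb{F}_q^{\,n}$ together with the points of the hyperplane at infinity, which are the symbols $[\ell]$, one for each $1$-dimensional subspace $\ell\subset\mathbb{F}_q^{\,n}$. A window $(p,p')$ of two points of $\mathrm{PG}(n,q)$ represents an affine line as follows: if $p,p'$ are distinct affine points, it represents the unique affine line through $p$ and $p'$; if one of them is an affine point $x$ and the other is a point at infinity $[\ell]$, it represents the affine line $x+\ell$; in all other cases (equal points, or two points at infinity) the window does not represent an affine line. *)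

theory Defs
  imports "HOL-Analysis.Cartesian_Space"
begin

definition directions :: "('a::field ^ 'n) set set" where
  "directions = {l. vec.subspace l \<and> vec.dim l = 1}"

definition affine_lines :: "('a::field ^ 'n) set set" where
  "affine_lines = {(+) x ` l | x l. l \<in> directions}"

(* AtInfinity l is a point of PG(n,q) only if l is a direction; see PG_points. *)
datatype 'v pg_point = Affine 'v | AtInfinity "'v set"

definition PG_points :: "('a::field ^ 'n) pg_point set" where
  "PG_points = range Affine \<union> AtInfinity ` directions"

fun represents ::
  "('a::field ^ 'n) pg_point \<Rightarrow> ('a ^ 'n) pg_point \<Rightarrow> ('a ^ 'n) set \<Rightarrow> bool" where
  "represents (Affine x) (Affine y) L \<longleftrightarrow>
     x \<noteq> y \<and> L \<in> affine_lines \<and> x \<in> L \<and> y \<in> L"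
| "represents (Affine x) (AtInfinity l) L \<longleftrightarrow> l \<in> directions \<and> L = (+) x ` l"
| "represents (AtInfinity l) (Affine x) L \<longleftrightarrow> l \<in> directions \<and> L = (+) x ` l"
| "represents (AtInfinity l) (AtInfinity l') L \<longleftrightarrow> False"

end

theory Submission
  imports Defs "HOL-Library.Multiset" "HOL-Number_Theory.Residues"
begin

text \<open>
  Split the directions into pairs, with one triple left over if their number is odd, and cover the
  lines of each part by a closed walk through the origin; these walks concatenate.

  For two directions \<open>\<langle>u\<rangle>\<close>, \<open>\<langle>v\<rangle>\<close> take a linear functional \<open>\<phi>\<close> with \<open>\<phi> u = \<phi> v = 1\<close>. Every line in
  either direction meets \<open>T = ker \<phi>\<close> exactly once, so the walk
  \<open>0, [\<langle>u\<rangle>], t\<^sub>1, [\<langle>v\<rangle>], t\<^sub>2, [\<langle>u\<rangle>], \<dots>\<close> through the elements of \<open>T\<close> closes up if \<open>|T|\<close> is even; if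
  \<open>|T|\<close> is odd, let it end at \<open>v - u \<in> T\<close> and return by \<open>v - u, v, 0\<close>.

  For three directions with \<open>\<phi> u = \<phi> v = \<phi> w = 1\<close>, keep the passages through \<open>[\<langle>u\<rangle>]\<close> and alternate
  them with detours \<open>s, s + w, [\<langle>v\<rangle>], t + w, t\<close>. If \<open>|T|\<close> is odd, return by
  \<open>2u - v - w, 2u - v, 2u, 0\<close>, which requires \<open>v + w \<noteq> 2u\<close>. Such a triple exists as soon as
  \<open>|T| = q\<^bsup>n-1\<^esup> \<ge> 4\<close>. Otherwise \<open>n = 2\<close> and \<open>q \<le> 3\<close>; the plane over \<open>F\<^sub>3\<close> has an even number of
  directions, and over \<open>F\<^sub>2\<close> a hexagon covers all six lines.
\<close>

section \<open>Affine lines\<close>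

lemma span_singleton_in_directions: "u \<noteq> 0 \<Longrightarrow> vec.span {u} \<in> directions"
  by (simp add: directions_def)

lemma subspace_direction: "l \<in> directions \<Longrightarrow> vec.subspace l"
  by (simp add: directions_def)

lemma direction_eq_span_singleton:
  assumes "l \<in> directions" "u \<in> l" "u \<noteq> 0"
  shows "l = vec.span {u}"
proof -
  have "vec.span {u} \<subseteq> l"
    using assms by (intro vec.span_minimal subspace_direction) auto
  then show ?thesis
    using assms span_singleton_in_directions[of u]
    by (intro vec.subspace_dim_equal[symmetric]) (auto simp: directions_def)
qed

lemma directionsE:
  assumes "l \<in> directions"
  obtains u where "u \<noteq> 0" "l = vec.span {u}"
proof -
  have "\<not> l \<subseteq> {0}"
    using assms vec.dim_eq_0[of l] by (simp add: directions_def)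
  then show thesis
    using direction_eq_span_singleton[OF assms] that by blast
qed

lemma direction_eqI:
  assumes "l \<in> directions" "l' \<in> directions" "x \<in> l" "x \<in> l'" "x \<noteq> 0"
  shows "l = l'"
  using assms direction_eq_span_singleton by metis

lemma mem_translate_iff: "y \<in> (+) x ` l \<longleftrightarrow> y - x \<in> l"
  for x y :: "'a::ab_group_add"
  by (metis add_diff_cancel_left' diff_add_cancel image_iff)

lemma translate_subspace_eq_iff:
  assumes "vec.subspace l"
  shows "(+) x ` l = (+) y ` l \<longleftrightarrow> x - y \<in> l"
proof
  assume "(+) x ` l = (+) y ` l"
  moreover have "x \<in> (+) x ` l"
    using vec.subspace_0[OF assms] by (simp add: mem_translate_iff)
  ultimately show "x - y \<in> l"
    by (simp add: mem_translate_iff)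
next
  assume "x - y \<in> l"
  then have "z - x \<in> l \<longleftrightarrow> z - y \<in> l" for z
    using vec.subspace_add[OF assms, of "z - x" "x - y"]
      vec.subspace_diff[OF assms, of "z - y" "x - y"]
    by auto
  then show "(+) x ` l = (+) y ` l"
    unfolding set_eq_iff mem_translate_iff by blast
qed

lemma translate_subspace_eqI:
  assumes "vec.subspace l" "y \<in> (+) x ` l"
  shows "(+) x ` l = (+) y ` l"
  using assms translate_subspace_eq_iff[of l y x] by (simp add: mem_translate_iff)

lemma translate_subspace_inj:
  assumes "vec.subspace l" "vec.subspace l'" "(+) x ` l = (+) y ` l'"
  shows "l = l'"
proof -
  have "x \<in> (+) x ` l"
    using vec.subspace_0[OF assms(1)] by (simp add: mem_translate_iff)
  then have "(+) y ` l' = (+) x ` l'"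
    using assms(2,3) by (intro translate_subspace_eqI) auto
  then show ?thesis
    using assms(3) inj_image_eq_iff[of "(+) x" l l'] by simp
qed

lemma translate_direction_in_affine_lines: "l \<in> directions \<Longrightarrow> (+) x ` l \<in> affine_lines"
  by (auto simp: affine_lines_def)

lemma line_through_two_points:
  assumes "L \<in> affine_lines" "x \<in> L" "y \<in> L" "x \<noteq> y"
  shows "L = (+) x ` vec.span {y - x}"
proof -
  obtain z l where L: "L = (+) z ` l" and l: "l \<in> directions"
    using assms(1) by (auto simp: affine_lines_def)
  note subspace = subspace_direction[OF l]
  have "x - z \<in> l" "y - z \<in> l"
    using assms(2,3) by (simp_all only: L mem_translate_iff)
  then have "y - x \<in> l"
    using vec.subspace_diff[OF subspace, of "y - z" "x - z"] by simp
  then have "l = vec.span {y - x}"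
    using l assms(4) by (intro direction_eq_span_singleton) auto
  moreover have "L = (+) x ` l"
    using assms(2) unfolding L by (rule translate_subspace_eqI[OF subspace])
  ultimately show ?thesis
    by simp
qed

lemma represents_unique:
  assumes "represents p q L" "represents p q L'"
  shows "L = L'"
proof (cases "\<exists>x y. p = Affine x \<and> q = Affine y")
  case True
  then obtain x y where "p = Affine x" "q = Affine y"
    by blast
  then show ?thesis
    using assms line_through_two_points[of L x y] line_through_two_points[of L' x y] by simp
next
  case False
  then show ?thesis
    using assms by (cases p; cases q) auto
qed

definition parallel_class :: "('a::field ^ 'n) set \<Rightarrow> ('a ^ 'n) set set" where
  "parallel_class l = range (\<lambda>x. (+) x ` l)"

lemma affine_lines_eq_Union_parallel_class: "affine_lines = \<Union> (parallel_class ` directions)"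
  by (auto simp: affine_lines_def parallel_class_def)

lemma mset_set_affine_lines:
  "mset_set (affine_lines :: ('a::{field,finite} ^ 'n) set set) =
    (\<Sum>l\<in>directions. mset_set (parallel_class l))"
proof -
  have "\<forall>l\<in>directions. \<forall>l'\<in>directions.
      l \<noteq> l' \<longrightarrow> parallel_class l \<inter> parallel_class l' = ({} :: ('a ^ 'n) set set)"
    using translate_subspace_inj by (auto simp: parallel_class_def dest!: subspace_direction)
  then have "(\<Sum>L\<in>affine_lines. {#L :: ('a ^ 'n) set#}) =
      (\<Sum>l\<in>directions. \<Sum>L\<in>parallel_class l. {#L#})"
    unfolding affine_lines_eq_Union_parallel_class by (intro sum.UNION_disjoint) auto
  then show ?thesis
    by simp
qed

lemma card_direction:
  fixes l :: "('a::field ^ 'n) set"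
  assumes "l \<in> directions"
  shows "card l = CARD('a)"
proof -
  obtain u where u: "u \<noteq> 0" "l = vec.span {u}"
    using assms by (rule directionsE)
  then have "inj (\<lambda>c. c *s u)"
    by (auto simp: inj_def)
  then show ?thesis
    by (simp add: u(2) vec.span_singleton card_image)
qed

lemma card_parallel_class:
  fixes l :: "('a::{field,finite} ^ 'n) set"
  assumes "l \<in> directions"
  shows "card (parallel_class l) = CARD('a) ^ (CARD('n) - 1)"
proof -
  note subspace = subspace_direction[OF assms]
  have "card L = CARD('a)" if "L \<in> parallel_class l" for L
    using that by (auto simp: parallel_class_def card_image card_direction[OF assms])
  moreover have "L = L'"
    if "L \<in> parallel_class l" "L' \<in> parallel_class l" "z \<in> L" "z \<in> L'" for L L' z
  proof -
    have "M = (+) z ` l" if M: "M \<in> parallel_class l" "z \<in> M" for M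
    proof -
      obtain x where "M = (+) x ` l"
        using M(1) by (auto simp: parallel_class_def)
      with M(2) show ?thesis
        using translate_subspace_eqI[OF subspace] by blast
    qed
    then show ?thesis
      using that by blast
  qed
  ultimately have "CARD('a) * card (parallel_class l) = card (\<Union> (parallel_class l))"
    by (intro card_partition) auto
  also have "\<Union> (parallel_class l) = UNIV"
  proof -
    have "x \<in> (+) x ` l" for x
      using vec.subspace_0[OF subspace] by (simp add: mem_translate_iff)
    then show ?thesis
      by (auto simp only: parallel_class_def)
  qed
  also have "card (UNIV :: ('a ^ 'n) set) = CARD('a) * CARD('a) ^ (CARD('n) - 1)"
    by (simp flip: power_Suc)
  finally show ?thesis
    by simp
qed

lemma card_directions:
  "(CARD('a) - 1) * card (directions :: ('a::{field,finite} ^ 'n) set set) =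
    CARD('a) ^ CARD('n) - 1"
proof -
  let ?punctured = "(\<lambda>l. l - {0}) ` (directions :: ('a ^ 'n) set set)"
  have zero: "0 \<in> l" if "l \<in> directions" for l :: "('a ^ 'n) set"
    using that by (intro vec.subspace_0 subspace_direction)
  have "inj_on (\<lambda>l. l - {0}) (directions :: ('a ^ 'n) set set)"
    by (rule inj_onI) (metis zero insert_Diff)
  then have "(CARD('a) - 1) * card (directions :: ('a ^ 'n) set set) =
      (CARD('a) - 1) * card ?punctured"
    by (simp add: card_image)
  also have "\<dots> = card (\<Union> ?punctured)"
  proof (rule card_partition)
    show "card c = CARD('a) - 1" if "c \<in> ?punctured" for c
      using that zero card_direction[where 'a = 'a and 'n = 'n] by auto
    show "c1 \<inter> c2 = {}" if "c1 \<in> ?punctured" "c2 \<in> ?punctured" "c1 \<noteq> c2" for c1 c2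
      using that direction_eqI by blast
  qed auto
  also have "\<Union> ?punctured = UNIV - {0}"
  proof -
    have "\<exists>l\<in>directions. x \<in> l - {0}" if "x \<noteq> 0" for x :: "'a ^ 'n"
      using that span_singleton_in_directions vec.span_base[of x "{x}"] by blast
    then show ?thesis
      by blast
  qed
  also have "card \<dots> = CARD('a) ^ CARD('n) - 1"
    by simp
  finally show ?thesis .
qed

section \<open>Linear functionals\<close>

locale linear_functional = Vector_Spaces.linear "(*s)" "(*)" \<phi>
  for \<phi> :: "'a::field ^ 'n \<Rightarrow> 'a"
begin

definition ker :: "('a ^ 'n) set" where
  "ker = {x. \<phi> x = 0}"

lemma direction_normalizedE:
  assumes "l \<in> directions" "\<not> l \<subseteq> ker"
  obtains u where "\<phi> u = 1" "l = vec.span {u}"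
proof -
  obtain v where v: "v \<in> l" "\<phi> v \<noteq> 0"
    using assms(2) by (auto simp: ker_def)
  define u where "u = inverse (\<phi> v) *s v"
  have "\<phi> u = 1"
    using v(2) by (simp add: u_def scale)
  moreover have "u \<in> l"
    using v(1) assms(1) by (simp add: u_def vec.subspace_scale subspace_direction)
  moreover have "u \<noteq> 0"
    using \<open>\<phi> u = 1\<close> zero by force
  ultimately show thesis
    using assms(1) direction_eq_span_singleton that by blast
qed

lemma span_singleton_normalized_in_directions: "\<phi> u = 1 \<Longrightarrow> vec.span {u} \<in> directions"
  using zero by (intro span_singleton_in_directions) auto

lemma span_singleton_normalized_inj:
  assumes "\<phi> u = 1" "\<phi> v = 1" "vec.span {u} = vec.span {v}"
  shows "u = v"
proof -
  obtain c where c: "u = c *s v"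
    using assms(3) vec.span_base[of u "{u}"] by (auto simp: vec.span_singleton)
  then have "c = 1"
    using assms(1,2) by (simp add: scale)
  with c show ?thesis
    by simp
qed

lemma bij_betw_ker_parallel_class:
  assumes "\<phi> u = 1"
  shows "bij_betw (\<lambda>t. (+) (t + a) ` vec.span {u}) ker (parallel_class (vec.span {u}))"
proof (rule bij_betwI')
  fix s t
  assume "s \<in> ker" "t \<in> ker"
  then have "\<phi> (s - t) = 0"
    by (simp add: ker_def diff)
  then have "s - t \<in> vec.span {u} \<longleftrightarrow> s - t = 0"
    using assms by (auto simp: vec.span_singleton scale)
  then show "(+) (s + a) ` vec.span {u} = (+) (t + a) ` vec.span {u} \<longleftrightarrow> s = t"
    by (simp add: translate_subspace_eq_iff)
next
  fix t
  show "(+) (t + a) ` vec.span {u} \<in> parallel_class (vec.span {u})"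
    by (simp add: parallel_class_def)
next
  fix L
  assume "L \<in> parallel_class (vec.span {u})"
  then obtain x where L: "L = (+) x ` vec.span {u}"
    by (auto simp: parallel_class_def)
  define t where "t = x - a - \<phi> (x - a) *s u"
  have "t \<in> ker"
    using assms by (simp add: ker_def t_def diff scale)
  moreover have "L = (+) (t + a) ` vec.span {u}"
    by (simp add: L t_def translate_subspace_eq_iff vec.span_scale vec.span_base)
  ultimately show "\<exists>t\<in>ker. L = (+) (t + a) ` vec.span {u}"
    by blast
qed

lemma mset_set_parallel_class:
  assumes "\<phi> u = 1"
  shows "mset_set (parallel_class (vec.span {u})) = (\<Sum>t\<in>ker. {#(+) (t + a) ` vec.span {u}#})"
  using sum.reindex_bij_betw[OF bij_betw_ker_parallel_class[OF assms], of "\<lambda>L. {#L#}" a] by simp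

lemma card_ker:
  assumes "\<phi> u = 1"
  shows "card ker = card (parallel_class (vec.span {u}))"
  using bij_betw_same_card[OF bij_betw_ker_parallel_class[OF assms]] .

lemma obtain_normalized_triple:
  assumes "\<phi> u = 1" "4 \<le> card ker"
  obtains v w where "\<phi> v = 1" "\<phi> w = 1" "distinct [u, v, w]" "v + w \<noteq> 2 *s u"
proof -
  have outside: "\<exists>x\<in>ker. x \<notin> F" if "card F \<le> 3" "finite F" for F
    using that assms(2) card_mono[of F ker] by force
  obtain s where s: "s \<in> ker" "s \<noteq> 0"
    using outside[of "{0}"] by auto
  obtain r where r: "r \<in> ker" "r \<notin> {0, s, - s}"
    using outside[of "{0, s, - s}"] card_length[of "[0, s, - s]"] by auto
  have "(u + s) + (u + r) - 2 *s u = r + s"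
    using vec.scale_left_distrib[of 1 1 u] by simp
  then have "(u + s) + (u + r) \<noteq> 2 *s u"
    using r(2) by (metis add_eq_0_iff2 diff_self insertCI)
  then show thesis
    using s r assms(1) by (intro that[of "u + s" "u + r"]) (auto simp: ker_def add)
qed

end

lemma linear_functional_iff:
  "linear_functional \<phi> \<longleftrightarrow> (\<forall>x y. \<phi> (x + y) = \<phi> x + \<phi> y) \<and> (\<forall>c x. \<phi> (c *s x) = c * \<phi> x)"
  unfolding linear_functional_def Vector_Spaces.linear_iff
  using vec.vector_space_axioms vector_space_over_itself.vector_space_axioms by blast

lemma linear_functional_nth: "linear_functional (\<lambda>x. x $ i)"
  by (simp add: linear_functional_iff)

lemma linear_functional_nonzero_at_two:
  fixes u v :: "'a::field ^ 'n"
  assumes "u \<noteq> 0" "v \<noteq> 0"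
  obtains \<phi> where "linear_functional \<phi>" "\<phi> u \<noteq> 0" "\<phi> v \<noteq> 0"
proof -
  obtain i j where ij: "u $ i \<noteq> 0" "v $ j \<noteq> 0"
    using assms by (auto simp: vec_eq_iff)
  have sum: "linear_functional (\<lambda>x::'a ^ 'n. x $ i + x $ j)"
    by (simp add: linear_functional_iff algebra_simps)
  consider "v $ i \<noteq> 0" | "u $ j \<noteq> 0" | "v $ i = 0" "u $ j = 0"
    by blast
  then show thesis
  proof cases
    case 1
    then show thesis using ij by (intro that[OF linear_functional_nth[of i]])
  next
    case 2
    then show thesis using ij by (intro that[OF linear_functional_nth[of j]])
  next
    case 3
    then show thesis using ij by (intro that[OF sum]) auto
  qed
qed

lemma two_neq_zero_if_odd_CARD:
  assumes "odd CARD('a::{field,finite})"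
  shows "(2 :: 'a) \<noteq> 0"
proof
  assume "(2 :: 'a) = 0"
  then have "CHAR('a) dvd 2"
    using of_nat_eq_0_iff_char_dvd[of 2, where 'a = 'a] by simp
  then have "CHAR('a) = 2"
    using CHAR_not_1'[where 'a = 'a] prime_nat_iff two_is_prime_nat by auto
  then show False
    using assms CHAR_dvd_CARD[where 'a = 'a] by simp
qed

lemma two_neq_zero_if_odd_card_ker:
  fixes \<phi> :: "'a::{field,finite} ^ 'n \<Rightarrow> 'a"
  assumes "linear_functional \<phi>" "\<phi> u = 1" "\<phi> v = 1" "u \<noteq> v"
    and odd: "odd (card (linear_functional.ker \<phi>))"
  shows "(2 :: 'a) \<noteq> 0"
proof (rule two_neq_zero_if_odd_CARD)
  interpret linear_functional \<phi> by fact
  have "0 \<in> ker" "u - v \<in> ker" "u - v \<noteq> 0"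
    using assms(2-4) zero by (simp_all add: ker_def diff)
  then have "card ker \<noteq> 1"
    by (metis card_1_singletonE singletonD)
  moreover have "card ker = CARD('a) ^ (CARD('n) - 1)"
    using assms(2) card_ker card_parallel_class span_singleton_normalized_in_directions by metis
  ultimately show "odd CARD('a)"
    using odd by auto
qed

section \<open>Walks\<close>

inductive walk ::
  "('a::field ^ 'n) pg_point \<Rightarrow> ('a ^ 'n) pg_point \<Rightarrow> ('a ^ 'n) set multiset \<Rightarrow> bool" where
  walk_Nil: "p \<in> PG_points \<Longrightarrow> walk p p {#}"
| walk_Cons: "p \<in> PG_points \<Longrightarrow> represents p p' L \<Longrightarrow> walk p' q M \<Longrightarrow> walk p q (add_mset L M)"

lemma walk_append: "walk p q M \<Longrightarrow> walk q r M' \<Longrightarrow> walk p r (M + M')"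
  by (induction rule: walk.induct) (auto intro: walk_Cons)

lemma walk_single:
  assumes "p \<in> PG_points" "q \<in> PG_points" "represents p q L"
  shows "walk p q {#L#}"
  using walk_Cons[OF assms(1,3) walk_Nil[OF assms(2)]] .

lemma walk_along_direction:
  assumes "l \<in> directions" "d \<in> l" "d \<noteq> 0"
  shows "walk (Affine x) (Affine (x + d)) {#(+) x ` l#}"
    and "walk (Affine (x + d)) (Affine x) {#(+) x ` l#}"
proof -
  have "x \<in> (+) x ` l" "x + d \<in> (+) x ` l"
    using assms(2) vec.subspace_0[OF subspace_direction[OF assms(1)]]
    by (simp_all add: mem_translate_iff)
  then have "represents (Affine x) (Affine (x + d)) ((+) x ` l)"
    "represents (Affine (x + d)) (Affine x) ((+) x ` l)"
    using assms(1,3) by (auto simp: affine_lines_def)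
  then show "walk (Affine x) (Affine (x + d)) {#(+) x ` l#}"
    "walk (Affine (x + d)) (Affine x) {#(+) x ` l#}"
    by (simp_all add: walk_single PG_points_def)
qed

lemma walk_via_infinity:
  assumes "l \<in> directions"
  shows "walk (Affine x) (Affine y) {#(+) x ` l, (+) y ` l#}"
proof -
  have "walk (Affine x) (AtInfinity l) {#(+) x ` l#}"
    "walk (AtInfinity l) (Affine y) {#(+) y ` l#}"
    using assms by (auto intro!: walk_single simp: PG_points_def)
  from walk_append[OF this] show ?thesis
    by (simp add: add_mset_commute)
qed

lemma walk_detour_via_infinity:
  assumes "l \<in> directions" "d \<in> l" "d \<noteq> 0" "m \<in> directions"
  shows "walk (Affine x) (Affine y)
    ({#(+) x ` l, (+) (x + d) ` m#} + {#(+) y ` l, (+) (y + d) ` m#})"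
proof -
  have "walk (Affine x) (Affine (x + d)) {#(+) x ` l#}"
    "walk (Affine (x + d)) (Affine (y + d)) {#(+) (x + d) ` m, (+) (y + d) ` m#}"
    "walk (Affine (y + d)) (Affine y) {#(+) y ` l#}"
    using walk_along_direction[OF assms(1-3)] walk_via_infinity[OF assms(4)] by blast+
  from walk_append[OF walk_append[OF this(1,2)] this(3)] show ?thesis
    by (simp add: add_mset_commute)
qed

lemma walk_to_zero_along_three_directions:
  assumes "l \<in> directions" "x \<in> l" "x \<noteq> 0" and "m \<in> directions" "y \<in> m" "y \<noteq> 0"
    and "k \<in> directions" "z \<in> k" "z \<noteq> 0"
  shows "walk (Affine (x - y - z)) (Affine 0) {#l, (+) (x - y) ` m, (+) (x - y - z) ` k#}"
proof -
  have "walk (Affine (x - y - z)) (Affine (x - y)) {#(+) (x - y - z) ` k#}"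
    using walk_along_direction(1)[OF assms(7-9), of "x - y - z"] by simp
  moreover have "walk (Affine (x - y)) (Affine x) {#(+) (x - y) ` m#}"
    using walk_along_direction(1)[OF assms(4-6), of "x - y"] by simp
  moreover have "walk (Affine x) (Affine 0) {#l#}"
    using walk_along_direction(2)[OF assms(1-3), of 0] by simp
  ultimately have "walk (Affine (x - y - z)) (Affine 0)
      ({#(+) (x - y - z) ` k#} + {#(+) (x - y) ` m#} + {#l#})"
    by (intro walk_append)
  then show ?thesis
    by (simp add: add_mset_commute)
qed

lemma walk_parallel_class_card_2:
  assumes "l \<in> directions" "card (parallel_class l) = 2" "x - y \<notin> l"
  shows "walk (Affine x) (Affine y) (mset_set (parallel_class l))"
proof -
  have distinct_lines: "(+) x ` l \<noteq> (+) y ` l"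
    using assms(1,3) by (simp add: translate_subspace_eq_iff subspace_direction)
  moreover have "finite (parallel_class l)"
    using assms(2) by (simp add: card_ge_0_finite)
  ultimately have "parallel_class l = {(+) x ` l, (+) y ` l}"
    using assms(2) by (intro card_subset_eq[symmetric]) (auto simp: parallel_class_def)
  then have "mset_set (parallel_class l) = {#(+) x ` l, (+) y ` l#}"
    using distinct_lines by simp
  then show ?thesis
    using walk_via_infinity[OF assms(1)] by simp
qed

lemma walk_imp_lists:
  assumes "walk p q M"
  shows "\<exists>ps Ls. length ps = Suc (length Ls) \<and> ps ! 0 = p \<and> ps ! length Ls = q \<and>
    set ps \<subseteq> PG_points \<and> mset Ls = M \<and>
    (\<forall>i<length Ls. represents (ps ! i) (ps ! Suc i) (Ls ! i))"
  using assms
proof induction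
  case (walk_Nil p)
  then show ?case
    by (intro exI[of _ "[p]"] exI[of _ "[]"]) auto
next
  case (walk_Cons p p' L q M)
  then obtain ps Ls where "length ps = Suc (length Ls)" "ps ! 0 = p'" "ps ! length Ls = q"
    "set ps \<subseteq> PG_points" "mset Ls = M"
    "\<forall>i<length Ls. represents (ps ! i) (ps ! Suc i) (Ls ! i)"
    by blast
  then show ?case
    using walk_Cons.hyps
    by (intro exI[of _ "p # ps"] exI[of _ "L # Ls"]) (auto simp: less_Suc_eq_0_disj)
qed

lemma closed_walk_enumeration:
  assumes "walk p p (mset_set \<L>)" "finite \<L>"
  obtains N P L where "bij_betw L {..<N} \<L>" "\<forall>i<N. P i \<in> PG_points"
    "\<forall>i<N. represents (P i) (P (Suc i mod N)) (L i)"
proof -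
  obtain ps Ls where length: "length ps = Suc (length Ls)" and closed: "ps ! 0 = ps ! length Ls"
    and points: "set ps \<subseteq> PG_points" and Ls: "mset Ls = mset_set \<L>"
    and windows: "\<forall>i<length Ls. represents (ps ! i) (ps ! Suc i) (Ls ! i)"
    using walk_imp_lists[OF assms(1)] by metis
  have set_Ls: "set Ls = \<L>"
    using Ls assms(2) by (metis finite_set_mset_mset_set set_mset_mset)
  then have "distinct Ls"
    using Ls by (metis card_distinct size_mset size_mset_set)
  then have "bij_betw ((!) Ls) {..<length Ls} \<L>"
    using set_Ls by (intro bij_betw_nth) auto
  moreover have "\<forall>i<length Ls. ps ! i \<in> PG_points"
    using points length by auto
  moreover have "\<forall>i<length Ls. represents (ps ! i) (ps ! (Suc i mod length Ls)) (Ls ! i)"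
    using windows by (metis closed less_Suc_eq mod_Suc mod_less nat_neq_iff)
  ultimately show thesis
    by (rule that)
qed

text \<open>Each \<open>t \<in> M\<close> is entered by one kind of step and left by the other.\<close>

lemma walk_alternating:
  assumes "finite M"
    and "\<And>s t. walk (Affine s) (Affine t) (\<alpha> s + \<alpha> t)"
    and "\<And>s t. walk (Affine s) (Affine t) (\<beta> s + \<beta> t)"
  shows "walk (Affine a) (Affine b)
    (\<alpha> a + (\<Sum>t\<in>M. \<alpha> t + \<beta> t) + (if even (card M) then \<alpha> b else \<beta> b))"
  using assms
proof (induction M arbitrary: a \<alpha> \<beta> rule: finite_induct)
  case empty
  then show ?case
    by simp
next
  case (insert m M)
  have "walk (Affine m) (Affine b)
      (\<beta> m + (\<Sum>t\<in>M. \<beta> t + \<alpha> t) + (if even (card M) then \<beta> b else \<alpha> b))"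
    by (rule insert.IH[OF insert.prems(2,1)])
  from walk_append[OF insert.prems(1)[of a m] this] show ?case
    using insert.hyps by (auto simp: ac_simps)
qed

lemma closed_walk_alternating:
  assumes \<alpha>: "\<And>s t. walk (Affine s) (Affine t) (\<alpha> s + \<alpha> t)"
    and \<beta>: "\<And>s t. walk (Affine s) (Affine t) (\<beta> s + \<beta> t)"
    and "finite T" "a \<in> T" "b \<in> T" "a \<noteq> b"
    and return: "odd (card T) \<Longrightarrow> walk (Affine b) (Affine a) (\<alpha> b + \<beta> a)"
  shows "walk (Affine a) (Affine a) (\<Sum>t\<in>T. \<alpha> t + \<beta> t)"
proof (cases "even (card T)")
  case True
  then have "odd (card (T - {a}))"
    using card.remove[OF assms(3,4)] by simp
  then show ?thesis
    using walk_alternating[of "T - {a}" \<alpha> \<beta> a a] \<alpha> \<beta> assms(3,4)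
    by (simp add: sum.remove[of T a] ac_simps)
next
  case False
  define M where "M = T - {a, b}"
  have T: "T = insert a (insert b M)" "a \<notin> insert b M" "b \<notin> M" "finite M"
    using assms(3-6) by (auto simp: M_def)
  then have "odd (card M)"
    using False by simp
  then have "walk (Affine a) (Affine b) (\<alpha> a + (\<Sum>t\<in>M. \<alpha> t + \<beta> t) + \<beta> b)"
    using walk_alternating[of M \<alpha> \<beta> a b] \<alpha> \<beta> T(4) by simp
  from walk_append[OF this return[OF False]] show ?thesis
    using T by (simp add: ac_simps)
qed

section \<open>Tours\<close>

definition has_tour :: "('a::field ^ 'n) set set \<Rightarrow> bool" where
  "has_tour D \<longleftrightarrow> walk (Affine 0) (Affine 0) (\<Sum>l\<in>D. mset_set (parallel_class l))"

lemma has_tour_empty: "has_tour {}"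
  by (simp add: has_tour_def walk_Nil PG_points_def)

lemma has_tour_Un:
  assumes "has_tour D" "has_tour D'" "finite D" "finite D'" "D \<inter> D' = {}"
  shows "has_tour (D \<union> D')"
  using assms walk_append by (simp add: has_tour_def sum.union_disjoint)

lemma has_tour_normalized_pair:
  fixes \<phi> :: "'a::{field,finite} ^ 'n \<Rightarrow> 'a"
  assumes "linear_functional \<phi>" and u: "\<phi> u = 1" and v: "\<phi> v = 1" and "u \<noteq> v"
  shows "has_tour {vec.span {u}, vec.span {v}}"
proof -
  interpret linear_functional \<phi> by fact
  let ?U = "vec.span {u}" and ?V = "vec.span {v}"
  have directions: "?U \<in> directions" "?V \<in> directions"
    using u v by (simp_all add: span_singleton_normalized_in_directions)
  have nonzero: "u \<noteq> 0" "v \<noteq> 0"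
    using u v zero by auto
  define \<alpha> \<beta> where "\<alpha> = (\<lambda>t. {#(+) t ` ?U#})" and "\<beta> = (\<lambda>t. {#(+) t ` ?V#})"
  have "walk (Affine 0) (Affine 0) (\<Sum>t\<in>ker. \<alpha> t + \<beta> t)"
  proof (rule closed_walk_alternating[where b = "v - u"])
    show "walk (Affine s) (Affine t) (\<alpha> s + \<alpha> t)" "walk (Affine s) (Affine t) (\<beta> s + \<beta> t)" for s t
      using directions[THEN walk_via_infinity, of s t]
      by (simp_all add: \<alpha>_def \<beta>_def add_mset_commute)
    show "0 \<in> ker" "v - u \<in> ker" "0 \<noteq> v - u"
      using assms zero by (auto simp: ker_def diff)
    have "walk (Affine (v - u)) (Affine v) (\<alpha> (v - u))"
      using walk_along_direction(1)[OF directions(1), of u "v - u"] nonzero(1)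
      by (simp add: \<alpha>_def vec.span_base)
    moreover have "walk (Affine v) (Affine 0) (\<beta> 0)"
      using walk_along_direction(2)[OF directions(2), of v 0] nonzero(2)
      by (simp add: \<beta>_def vec.span_base)
    ultimately show "walk (Affine (v - u)) (Affine 0) (\<alpha> (v - u) + \<beta> 0)"
      using walk_append by metis
  qed simp
  moreover have "(\<Sum>t\<in>ker. \<alpha> t + \<beta> t) =
      mset_set (parallel_class ?U) + mset_set (parallel_class ?V)"
    unfolding mset_set_parallel_class[OF u, of 0] mset_set_parallel_class[OF v, of 0]
      sum.distrib[symmetric]
    by (simp add: \<alpha>_def \<beta>_def add_mset_commute)
  moreover have "?U \<noteq> ?V"
    using assms span_singleton_normalized_inj by blast
  ultimately show ?thesis
    by (simp add: has_tour_def)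
qed

lemma has_tour_pair:
  fixes l l' :: "('a::{field,finite} ^ 'n) set"
  assumes "l \<in> directions" "l' \<in> directions" "l \<noteq> l'"
  shows "has_tour {l, l'}"
proof -
  obtain x y where xy: "x \<noteq> 0" "l = vec.span {x}" "y \<noteq> 0" "l' = vec.span {y}"
    using assms by (metis directionsE)
  obtain \<phi> where \<phi>: "linear_functional \<phi>" "\<phi> x \<noteq> 0" "\<phi> y \<noteq> 0"
    using linear_functional_nonzero_at_two[OF xy(1,3)] .
  interpret linear_functional \<phi> by fact
  have "\<not> l \<subseteq> ker" "\<not> l' \<subseteq> ker"
    using xy(2,4) \<phi>(2,3) vec.span_base[of x "{x}"] vec.span_base[of y "{y}"]
    by (auto simp: ker_def)
  then obtain u v where "\<phi> u = 1" "l = vec.span {u}" "\<phi> v = 1" "l' = vec.span {v}"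
    using direction_normalizedE[OF assms(1)] direction_normalizedE[OF assms(2)] by metis
  then show ?thesis
    using \<phi>(1) assms(3) by (auto intro: has_tour_normalized_pair)
qed

lemma has_tour_even:
  fixes D :: "('a::{field,finite} ^ 'n) set set"
  assumes "D \<subseteq> directions" "even (card D)"
  shows "has_tour D"
proof -
  obtain k where "card D = 2 * k"
    using assms(2) by blast
  with assms(1) show ?thesis
  proof (induction k arbitrary: D)
    case 0
    then show ?case
      using has_tour_empty by simp
  next
    case (Suc k)
    then obtain E where E: "E \<subseteq> D" "card E = 2"
      using obtain_subset_with_card_n[of 2 D] by auto
    then obtain l l' where "E = {l, l'}" "l \<noteq> l'"
      by (auto simp: card_2_iff)
    then have "has_tour E"
      using Suc.prems(1) E(1) by (auto intro!: has_tour_pair)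
    moreover have "has_tour (D - E)"
      using Suc E by (intro Suc.IH) (auto simp: card_Diff_subset)
    ultimately have "has_tour (E \<union> (D - E))"
      by (intro has_tour_Un) auto
    then show ?case
      using E(1) by (simp add: Un_absorb1)
  qed
qed

lemma has_tour_normalized_triple:
  fixes \<phi> :: "'a::{field,finite} ^ 'n \<Rightarrow> 'a"
  assumes "linear_functional \<phi>" and u: "\<phi> u = 1" and v: "\<phi> v = 1" and w: "\<phi> w = 1"
    and distinct: "distinct [u, v, w]" and "v + w \<noteq> 2 *s u"
  shows "has_tour {vec.span {u}, vec.span {v}, vec.span {w}}"
proof -
  interpret linear_functional \<phi> by fact
  let ?U = "vec.span {u}" and ?V = "vec.span {v}" and ?W = "vec.span {w}"
  have directions: "?U \<in> directions" "?V \<in> directions" "?W \<in> directions"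
    using u v w by (simp_all add: span_singleton_normalized_in_directions)
  have nonzero: "u \<noteq> 0" "v \<noteq> 0" "w \<noteq> 0"
    using u v w zero by auto
  define \<alpha> \<beta> where "\<alpha> = (\<lambda>t. {#(+) t ` ?W, (+) (t + w) ` ?V#})" and "\<beta> = (\<lambda>t. {#(+) t ` ?U#})"
  define b where "b = 2 *s u - v - w"
  have "walk (Affine 0) (Affine 0) (\<Sum>t\<in>ker. \<alpha> t + \<beta> t)"
  proof (rule closed_walk_alternating[where b = b])
    show "walk (Affine s) (Affine t) (\<alpha> s + \<alpha> t)" for s t
      unfolding \<alpha>_def using directions nonzero(3)
      by (intro walk_detour_via_infinity) (simp_all add: vec.span_base)
    show "walk (Affine s) (Affine t) (\<beta> s + \<beta> t)" for s t
      using walk_via_infinity[OF directions(1), of s t] by (simp add: \<beta>_def add_mset_commute)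
    show "0 \<in> ker" "b \<in> ker" "0 \<noteq> b"
      using assms zero by (auto simp: b_def ker_def add diff scale diff_diff_eq)
  next
    assume "odd (card ker)"
    then have "2 *s u \<noteq> 0"
      using two_neq_zero_if_odd_card_ker[OF assms(1) u v] distinct nonzero(1) by simp
    then show "walk (Affine b) (Affine 0) (\<alpha> b + \<beta> 0)"
      using walk_to_zero_along_three_directions[of ?U "2 *s u" ?V v ?W w] directions nonzero
      by (simp add: \<alpha>_def \<beta>_def b_def add_mset_commute vec.span_base vec.span_scale)
  qed simp
  moreover have "(\<Sum>t\<in>ker. \<alpha> t + \<beta> t) =
      mset_set (parallel_class ?U) + mset_set (parallel_class ?V) + mset_set (parallel_class ?W)"
    unfolding mset_set_parallel_class[OF u, of 0] mset_set_parallel_class[OF v, of w]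
      mset_set_parallel_class[OF w, of 0]
    by (simp add: \<alpha>_def \<beta>_def sum.distrib[symmetric] add_mset_commute)
  moreover have "?U \<noteq> ?V" "?U \<noteq> ?W" "?V \<noteq> ?W"
    using u v w distinct span_singleton_normalized_inj by auto
  ultimately show ?thesis
    by (simp add: has_tour_def add.assoc)
qed

lemma has_tour_triangle:
  fixes l\<^sub>1 l\<^sub>2 l\<^sub>3 :: "('a::{field,finite} ^ 'n) set"
  assumes directions: "l\<^sub>1 \<in> directions" "l\<^sub>2 \<in> directions" "l\<^sub>3 \<in> directions"
    and distinct: "distinct [l\<^sub>1, l\<^sub>2, l\<^sub>3]" and "CARD('a) ^ (CARD('n) - 1) = 2"
  shows "has_tour {l\<^sub>1, l\<^sub>2, l\<^sub>3}"
proof -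
  obtain u v where uv: "u \<in> l\<^sub>1" "u \<noteq> 0" "v \<in> l\<^sub>2" "v \<noteq> 0"
    using directions(1,2) by (metis directionsE singletonI vec.span_base)
  then have "v \<notin> l\<^sub>1" "u \<notin> l\<^sub>2" "u \<notin> l\<^sub>3"
    using distinct directions direction_eqI by auto
  then have "0 - v \<notin> l\<^sub>1" "v - u \<notin> l\<^sub>2" "u - 0 \<notin> l\<^sub>3"
    using uv(3) vec.subspace_neg[of l\<^sub>1 "- v"] vec.subspace_diff[of l\<^sub>2 v "v - u"]
      directions[THEN subspace_direction] by auto
  then have "walk (Affine 0) (Affine v) (mset_set (parallel_class l\<^sub>1))"
    "walk (Affine v) (Affine u) (mset_set (parallel_class l\<^sub>2))"
    "walk (Affine u) (Affine 0) (mset_set (parallel_class l\<^sub>3))"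
    using assms(5) directions
    by (auto intro!: walk_parallel_class_card_2 simp: card_parallel_class)
  then have "walk (Affine 0) (Affine 0) (mset_set (parallel_class l\<^sub>1) +
      mset_set (parallel_class l\<^sub>2) + mset_set (parallel_class l\<^sub>3))"
    by (intro walk_append)
  then show ?thesis
    using distinct by (simp add: has_tour_def add.assoc)
qed

lemma CARD_eq_2_if_odd_card_directions:
  assumes "2 \<le> CARD('n)" "CARD('a) ^ (CARD('n) - 1) < 4"
    and odd: "odd (card (directions :: ('a::{field,finite} ^ 'n) set set))"
  shows "CARD('a) = 2" "CARD('n) = 2"
proof -
  have q: "2 \<le> CARD('a)"
    using card_mono[of UNIV "{0, 1 :: 'a}"] by simp
  then have "2 ^ (CARD('n) - 1) \<le> CARD('a) ^ (CARD('n) - 1)"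
    by (rule power_mono) simp
  then have "(2 :: nat) ^ (CARD('n) - 1) < 2 ^ 2"
    using assms(2) by simp
  then have "CARD('n) - 1 < 2"
    by (rule power_less_imp_less_exp[rotated]) simp
  then show n: "CARD('n) = 2"
    using assms(1) by simp
  have "CARD('a) \<noteq> 3"
    using card_directions[where 'a = 'a and 'n = 'n] odd n by auto
  then show "CARD('a) = 2"
    using q n assms(2) by auto
qed

lemma obtain_three_directions_with_tour:
  assumes "2 \<le> CARD('n)" "odd (card (directions :: ('a::{field,finite} ^ 'n) set set))"
  obtains T :: "('a::{field,finite} ^ 'n) set set"
    where "T \<subseteq> directions" "card T = 3" "has_tour T"
proof (cases "4 \<le> CARD('a) ^ (CARD('n) - 1)")
  case True
  fix i :: 'n
  interpret linear_functional "\<lambda>x :: 'a ^ 'n. x $ i"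
    by (rule linear_functional_nth)
  let ?u = "axis i 1 :: 'a ^ 'n"
  have u: "?u $ i = 1"
    by (simp add: axis_def)
  then have "4 \<le> card ker"
    using True card_ker card_parallel_class span_singleton_normalized_in_directions by metis
  with u obtain v w where vw: "v $ i = 1" "w $ i = 1" "distinct [?u, v, w]" "v + w \<noteq> 2 *s ?u"
    by (rule obtain_normalized_triple)
  show thesis
  proof (rule that)
    show "{vec.span {?u}, vec.span {v}, vec.span {w}} \<subseteq> directions"
      using u vw(1,2) span_singleton_normalized_in_directions by blast
    show "card {vec.span {?u}, vec.span {v}, vec.span {w}} = 3"
      using u vw span_singleton_normalized_inj by (fastforce simp: card_insert_if)
    show "has_tour {vec.span {?u}, vec.span {v}, vec.span {w}}"
      using linear_functional_nth u vw by (rule has_tour_normalized_triple)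
  qed
next
  case False
  then have CARD: "CARD('a) = 2" "CARD('n) = 2"
    using CARD_eq_2_if_odd_card_directions[where 'a = 'a and 'n = 'n] assms by auto
  then have card: "card (directions :: ('a ^ 'n) set set) = 3"
    using card_directions[where 'a = 'a and 'n = 'n] by simp
  then obtain l\<^sub>1 l\<^sub>2 l\<^sub>3 :: "('a ^ 'n) set"
    where l: "directions = {l\<^sub>1, l\<^sub>2, l\<^sub>3}" "distinct [l\<^sub>1, l\<^sub>2, l\<^sub>3]"
    by (auto simp: card_3_iff)
  have "has_tour {l\<^sub>1, l\<^sub>2, l\<^sub>3}"
    using l CARD by (intro has_tour_triangle) auto
  then have "has_tour (directions :: ('a ^ 'n) set set)"
    by (simp add: l(1))
  then show thesis
    using card that by blast
qed

lemma has_tour_directions: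
  assumes "2 \<le> CARD('n)"
  shows "has_tour (directions :: ('a::{field,finite} ^ 'n) set set)"
proof (cases "even (card (directions :: ('a ^ 'n) set set))")
  case True
  then show ?thesis
    by (intro has_tour_even) auto
next
  case False
  obtain T :: "('a ^ 'n) set set" where T: "T \<subseteq> directions" "card T = 3" "has_tour T"
    using obtain_three_directions_with_tour[OF assms False] .
  then have "has_tour (directions - T)"
    using False card_mono[OF finite T(1)] by (intro has_tour_even) (auto simp: card_Diff_subset)
  then have "has_tour (T \<union> (directions - T))"
    using T(3) by (intro has_tour_Un) auto
  then show ?thesis
    using T(1) by (simp add: Un_absorb1)
qed

theorem mainTheorem1:
  assumes "CARD('n::finite) \<ge> 2"
  shows "\<exists>(N::nat) (p :: nat \<Rightarrow> ('a::{field,finite} ^ 'n) pg_point).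
    N \<ge> 1 \<and>
    (\<forall>i<N. p i \<in> PG_points) \<and>
    (\<forall>i<N. \<exists>!L. L \<in> affine_lines \<and> represents (p i) (p ((i + 1) mod N)) L) \<and>
    (\<forall>L \<in> affine_lines. \<exists>!i. i < N \<and> represents (p i) (p ((i + 1) mod N)) L)"
proof -
  let ?lines = "affine_lines :: ('a ^ 'n) set set"
  have "walk (Affine 0) (Affine 0) (mset_set ?lines)"
    using has_tour_directions[OF assms] by (simp add: has_tour_def mset_set_affine_lines)
  then obtain N P L where L: "bij_betw L {..<N} ?lines" and P: "\<forall>i<N. P i \<in> PG_points"
    and windows: "\<forall>i<N. represents (P i) (P (Suc i mod N)) (L i)"
    using closed_walk_enumeration[OF _ finite] by metis
  then have represents_iff: "represents (P i) (P ((i + 1) mod N)) M \<longleftrightarrow> M = L i" if "i < N" for i M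
    using that by (metis Suc_eq_plus1 represents_unique)
  have "?lines \<noteq> {}"
    using translate_direction_in_affine_lines[OF span_singleton_in_directions[of 1]] by auto
  then have "N \<ge> 1"
    using L by (cases N) (auto simp: bij_betw_def)
  moreover have "\<forall>i<N. \<exists>!M. M \<in> affine_lines \<and> represents (P i) (P ((i + 1) mod N)) M"
    using represents_iff bij_betwE[OF L] by auto
  moreover have "\<forall>M\<in>affine_lines. \<exists>!i. i < N \<and> represents (P i) (P ((i + 1) mod N)) M"
  proof -
    have "\<forall>M\<in>?lines. \<exists>!i. i < N \<and> M = L i"
      using L unfolding bij_betw_def inj_on_def by (metis imageE lessThan_iff)
    then show ?thesis
      using represents_iff by (simp cong: conj_cong)
  qed
  ultimately show ?thesis
    using P by blast
qed

end
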